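(* Let $\mathcal{H}$ be a complex separable Hilbert space and let $\mathcal{M},\mathcal{N}$ be linear subspaces of $\mathcal{H}$. Let $P$ be the orthogonal projection onto $\overline{\mathcal{M}^{\perp}+\mathcal{N}^{\perp}}$ and $Q$ the orthogonal projection onto $(\mathcal{M}\cap\mathcal{N})^{\perp}$. Put $(P_{\mathcal{M},\mathcal{N}})_{\mathrm{reg}}=P\,P_{\mathcal{M},\mathcal{N}}$ and $(P_{\mathcal{M},\mathcal{N}})_m=Q\,P_{\mathcal{M},\mathcal{N}}$. Then: 1. $(P_{\mathcal{M},\mathcal{N}})_{\mathrm{reg}}$ is a projection if and only if $\mathcal{M}+\mathcal{N}=P(\mathcal{M})+(\mathcal{M}\cap\overline{\mathcal{N}})+\mathcal{N}$ and $P(\mathcal{M})\subseteq\mathcal{M}+(\mathcal{N}\cap\overline{\mathcal{M}})$. 2. $(P_{\mathcal{M},\mathcal{N}})_m$ is a projection if and only if $\mathcal{M}+\mathcal{N}=Q(\mathcal{M})+(\mathcal{M}\cap\overline{\mathcal{M}\cap\mathcal{N}})+\mathcal{N}$ and $Q(\mathcal{M})\subseteq\mathcal{M}+(\mathcal{N}\cap\overline{\mathcal{M}\cap\mathcal{N}})$.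
   Context: A linear relation on $\mathcal{H}$ is a linear subspace of $\mathcal{H}\times\mathcal{H}$; operators (possibly not everywhere defined or unbounded) are identified with their graphs. The product of relations is $RT=\{(x,y):(x,z)\in T,(z,y)\in R\text{ for some }z\}$. For subspaces $\mathcal{M},\mathcal{N}$, $P_{\mathcal{M},\mathcal{N}}=\{(m+n,m):m\in\mathcal{M},n\in\mathcal{N}\}$. A projection is a linear relation $E$ with $E^2=E$, $\operatorname{ran}E\subseteq\operatorname{dom}E$ and $\operatorname{mul}E=\{y:(0,y)\in E\}=\{0\}$, i.e. a (not necessarily everywhere defined or bounded) idempotent operator with range contained in its domain. *)

theory Defs
  imports "HOL-Analysis.Analysis"
begin

section \<open>Complex Hilbert spaces\<close>

class complex_vector = real_vector +
  fixes scaleC :: "complex \<Rightarrow> 'a \<Rightarrow> 'a" (infixr \<open>*\<^sub>C\<close> 75)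
  assumes scaleC_add_right: "a *\<^sub>C (x + y) = a *\<^sub>C x + a *\<^sub>C y"
    and scaleC_add_left: "(a + b) *\<^sub>C x = a *\<^sub>C x + b *\<^sub>C x"
    and scaleC_scaleC: "a *\<^sub>C b *\<^sub>C x = (a * b) *\<^sub>C x"
    and scaleC_one: "1 *\<^sub>C x = x"
    and scaleR_scaleC: "scaleR r x = complex_of_real r *\<^sub>C x"

global_interpretation complex_vector: vector_space "scaleC :: complex \<Rightarrow> 'a \<Rightarrow> 'a :: complex_vector"
  defines csubspace = complex_vector.subspace
  by unfold_locales (simp_all add: scaleC_add_right scaleC_add_left scaleC_scaleC scaleC_one)

text \<open>
  The complex inner product is linear in its first argument and conjugate-linear in the
  second. Its real part is the real inner product of class \<open>real_inner\<close>, so norm and topology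
  are those induced by \<open>cinner\<close>, and positive definiteness is inherited from there
  (\<open>cinner_commute\<close> makes \<open>cinner x x\<close> real).
\<close>

class complex_inner = complex_vector + real_inner +
  fixes cinner :: "'a \<Rightarrow> 'a \<Rightarrow> complex"
  assumes cinner_commute: "cinner x y = cnj (cinner y x)"
    and cinner_add_left: "cinner (x + y) z = cinner x z + cinner y z"
    and cinner_scaleC_left: "cinner (a *\<^sub>C x) y = a * cinner x y"
    and inner_eq_Re_cinner: "inner x y = Re (cinner x y)"

class chilbert_space = complex_inner + complete_space

instantiation complex :: chilbert_space
begin
definition scaleC_complex :: "complex \<Rightarrow> complex \<Rightarrow> complex" where "scaleC_complex a x = a * x"
definition cinner_complex :: "complex \<Rightarrow> complex \<Rightarrow> complex" where "cinner_complex x y = x * cnj y"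
instance
  by intro_classes
    (simp_all add: scaleC_complex_def cinner_complex_def inner_complex_def algebra_simps
      scaleR_conv_of_real)
end

instantiation prod :: (complex_vector, complex_vector) complex_vector
begin
definition scaleC_prod :: "complex \<Rightarrow> 'a \<times> 'b \<Rightarrow> 'a \<times> 'b"
  where "scaleC_prod a p = (a *\<^sub>C fst p, a *\<^sub>C snd p)"
instance
  by intro_classes
    (simp_all add: scaleC_prod_def prod_eq_iff scaleC_add_right scaleC_add_left scaleC_scaleC
      scaleC_one scaleR_scaleC)
end

definition orth_compl :: "'a::complex_inner set \<Rightarrow> 'a set"
  where "orth_compl M = {x. \<forall>m\<in>M. cinner x m = 0}"

text \<open>
  Meaningful when \<open>S\<close> is a closed subspace of a Hilbert space: the projection theorem then
  gives existence and uniqueness of \<open>y\<close>.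
\<close>

definition orth_proj :: "'a::complex_inner set \<Rightarrow> 'a \<Rightarrow> 'a"
  where "orth_proj S x = (THE y. y \<in> S \<and> x - y \<in> orth_compl S)"


section \<open>Linear relations\<close>

definition linear_relation :: "('a \<times> 'a::complex_vector) set \<Rightarrow> bool"
  where "linear_relation E \<longleftrightarrow> csubspace E"

definition op_graph :: "('a \<Rightarrow> 'a) \<Rightarrow> ('a \<times> 'a) set"
  where "op_graph f = {(x, f x) | x. True}"

text \<open>\<open>T\<close> is applied first, so \<open>rel_product R T\<close> is \<open>T O R\<close>.\<close>

definition rel_product :: "('a \<times> 'a) set \<Rightarrow> ('a \<times> 'a) set \<Rightarrow> ('a \<times> 'a) set"
  where "rel_product R T = {(x, y). \<exists>z. (x, z) \<in> T \<and> (z, y) \<in> R}"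

definition mul :: "('a \<times> 'a::zero) set \<Rightarrow> 'a set"
  where "mul E = {y. (0, y) \<in> E}"

definition proj_rel :: "'a::complex_vector set \<Rightarrow> 'a set \<Rightarrow> ('a \<times> 'a) set"
  where "proj_rel M N = {(m + n, m) | m n. m \<in> M \<and> n \<in> N}"

definition is_projection :: "('a \<times> 'a::complex_vector) set \<Rightarrow> bool"
  where "is_projection E \<longleftrightarrow>
    linear_relation E \<and> rel_product E E = E \<and> Range E \<subseteq> Domain E \<and> mul E = {0}"

end

theory Submission
  imports Defs
begin

text \<open>
  Let \<open>P\<close> be the orthogonal projection with kernel \<open>K\<close>, where \<open>M \<inter> N \<subseteq> K\<close>. The relation
  \<open>P P\<^bsub>M,N\<^esub>\<close> is the operator \<open>m + n \<mapsto> P m\<close>, so it is a projection iff for every \<open>m \<in> M\<close>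
  there are \<open>m' \<in> M\<close>, \<open>n' \<in> N\<close> with \<open>P m = m' + n'\<close> and \<open>P m = P m'\<close>. Since \<open>P\<close> is idempotent,
  the last equation says \<open>n' \<in> K\<close>, that is \<open>P(M) \<subseteq> M + (N \<inter> K)\<close>. This inclusion already
  implies \<open>M + N = P(M) + (M \<inter> K) + N\<close>, because \<open>m = P m + (m - m') - n'\<close>. In the two
  cases \<open>K\<close> is \<open>closure M \<inter> closure N\<close> and \<open>closure (M \<inter> N)\<close>.
\<close>

section \<open>Orthogonal projections in Hilbert spaces\<close>

lemma cinner_add_right: "cinner x (y + z) = cinner x y + cinner x (z :: 'a::complex_inner)"
  by (metis cinner_add_left cinner_commute complex_cnj_add)

lemma cinner_scaleC_right: "cinner x (a *\<^sub>C y) = cnj a * cinner x (y :: 'a::complex_inner)"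
  by (metis cinner_commute cinner_scaleC_left complex_cnj_mult)

lemma cinner_zero_left [simp]: "cinner 0 (y :: 'a::complex_inner) = 0"
  using cinner_add_left[of 0 0 y] by simp

lemma cinner_eq_0_commute: "cinner x y = 0 \<longleftrightarrow> cinner y (x :: 'a::complex_inner) = 0"
  by (metis cinner_commute complex_cnj_zero)

text \<open>Conjugate-linearity in the second argument turns the factor \<open>\<i>\<close> into
  \<open>- \<i>\<close>, and the real part of \<open>- \<i> * z\<close> is the imaginary part of
  \<open>z\<close>. This reduces complex orthogonality to two real conditions, so continuity,
  closedness and best approximation can be argued with \<open>inner\<close>.\<close>

lemma cinner_eq_Complex: "cinner x y = Complex (inner x y) (inner x (\<i> *\<^sub>C (y :: 'a::complex_inner)))"
  by (simp add: complex_eq_iff inner_eq_Re_cinner cinner_scaleC_right)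

text \<open>Supplies the bound that makes multiplication by a fixed complex scalar a bounded
  real-linear map, as needed for closures.\<close>

lemma norm_scaleC: "norm (a *\<^sub>C x) = cmod a * norm (x :: 'a::complex_inner)"
proof -
  have "cinner (a *\<^sub>C x) (a *\<^sub>C x) = (a * cnj a) * cinner x x"
    by (simp add: cinner_scaleC_left cinner_scaleC_right)
  then have "Re (cinner (a *\<^sub>C x) (a *\<^sub>C x)) = (cmod a)\<^sup>2 * Re (cinner x x)"
    by (simp flip: complex_norm_square)
  then have "(norm (a *\<^sub>C x))\<^sup>2 = (cmod a * norm x)\<^sup>2"
    by (simp add: power2_norm_eq_inner[where 'a = 'a] inner_eq_Re_cinner[where 'a = 'a]
        power_mult_distrib)
  then show ?thesis
    by (simp add: power2_eq_iff_nonneg)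
qed

lemma csubspace_imp_subspace: "csubspace S \<Longrightarrow> subspace (S :: 'a::complex_vector set)"
  by (auto simp: subspace_def complex_vector.subspace_def scaleR_scaleC)

lemma csubspace_closure:
  assumes "csubspace (S :: 'a::complex_inner set)"
  shows "csubspace (closure S)"
  unfolding complex_vector.subspace_def
proof (intro conjI ballI allI)
  show "0 \<in> closure S"
    using assms closure_subset complex_vector.subspace_0 by blast
  show "x + y \<in> closure S" if xy: "x \<in> closure S" "y \<in> closure S" for x y
  proof -
    obtain f g where "\<And>n. f n \<in> S" "f \<longlonglongrightarrow> x" "\<And>n. g n \<in> S" "g \<longlonglongrightarrow> y"
      using xy by (auto simp: closure_sequential)
    then have "\<And>n. f n + g n \<in> S" "(\<lambda>n. f n + g n) \<longlonglongrightarrow> x + y"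
      using assms by (auto intro: complex_vector.subspace_add tendsto_add)
    then show ?thesis
      unfolding closure_sequential by metis
  qed
  show "c *\<^sub>C x \<in> closure S" if "x \<in> closure S" for c x
  proof -
    have "bounded_linear (\<lambda>x :: 'a. c *\<^sub>C x)"
      by (rule bounded_linear_intro[where K = "cmod c"])
        (simp_all add: scaleC_add_right scaleR_scaleC scaleC_scaleC norm_scaleC mult.commute)
    then have "(\<lambda>x. c *\<^sub>C x) ` closure S \<subseteq> closure ((\<lambda>x. c *\<^sub>C x) ` S)"
      by (rule closure_bounded_linear_image_subset)
    also have "\<dots> \<subseteq> closure S"
      using assms by (intro closure_mono) (auto simp: complex_vector.subspace_def)
    finally show ?thesis
      using that by blast
  qed
qed

lemma csubspace_set_plus:
  assumes "csubspace A" "csubspace (B :: 'a::complex_vector set)"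
  shows "csubspace (A + B)"
proof -
  have "A + B = {a + b | a b. a \<in> A \<and> b \<in> B}"
    by (auto simp: set_plus_def)
  then show ?thesis
    using complex_vector.subspace_sums[OF assms] by simp
qed

lemma csubspace_orth_compl: "csubspace (orth_compl (M :: 'a::complex_inner set))"
  by (auto simp: complex_vector.subspace_def orth_compl_def cinner_add_left cinner_scaleC_left)

lemma orth_compl_closure: "orth_compl (closure M) = orth_compl (M :: 'a::complex_inner set)"
proof
  show "orth_compl (closure M) \<subseteq> orth_compl M"
    using closure_subset by (auto simp: orth_compl_def)
  have "cinner x m = 0" if "x \<in> orth_compl M" "m \<in> closure M" for x m
  proof (rule continuous_constant_on_closure[OF _ _ that(2)])
    \<comment> \<open>The factor \<open>\<i>\<close> is moved to the fixed argument, so that the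
      variable \<open>y\<close> stands alone in \<open>inner\<close> and continuity of the real
      inner product applies.\<close>
    have "continuous_on (closure M) (\<lambda>y. Complex (inner x y) (- inner (\<i> *\<^sub>C x) y))"
      by (intro continuous_intros)
    moreover have "inner x (\<i> *\<^sub>C y) = - inner (\<i> *\<^sub>C x) y" for y
      by (simp add: inner_eq_Re_cinner cinner_scaleC_left cinner_scaleC_right)
    ultimately show "continuous_on (closure M) (\<lambda>y. cinner x y)"
      by (simp add: cinner_eq_Complex)
  qed (use that in \<open>auto simp: orth_compl_def\<close>)
  then show "orth_compl M \<subseteq> orth_compl (closure M)"
    by (auto simp: orth_compl_def)
qed

text \<open>Each vector of \<open>M\<close> contributes two closed real hyperplanes, one for the
  real and one for the imaginary part of \<open>cinner\<close>.\<close>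

lemma closed_orth_compl: "closed (orth_compl (M :: 'a::complex_inner set))"
proof -
  have "orth_compl M = (\<Inter>m\<in>M. {x. inner m x = 0} \<inter> {x. inner (\<i> *\<^sub>C m) x = 0})"
  proof -
    have "cinner x m = 0 \<longleftrightarrow> inner m x = 0 \<and> inner (\<i> *\<^sub>C m) x = 0" for x m :: 'a
      by (simp add: cinner_eq_Complex complex_eq_iff inner_commute)
    then show ?thesis
      by (auto simp: orth_compl_def)
  qed
  then show ?thesis
    by (auto intro!: closed_INT closed_Int closed_hyperplane)
qed

section \<open>Best approximation and the projection theorem\<close>

text \<open>Convexity and the parallelogram law make a minimising sequence Cauchy. Completeness then
  provides its limit, so no compactness is involved.\<close>

lemma ex_closest_point_complete:
  fixes x :: "'a::{real_inner, complete_space}"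
  assumes "closed S" "convex S" "S \<noteq> {}"
  obtains y where "y \<in> S" "\<And>z. z \<in> S \<Longrightarrow> dist x y \<le> dist x z"
proof -
  define d where "d = infdist x S"
  have d_le: "d \<le> dist x z" if "z \<in> S" for z
    using that by (simp add: d_def infdist_le)
  have "\<exists>t\<in>S. dist x t < d + 1 / Suc n" for n
  proof (rule ccontr)
    assume "\<not> ?thesis"
    then have "d + 1 / Suc n \<le> infdist x S"
      unfolding infdist_def using \<open>S \<noteq> {}\<close> by (auto intro!: cINF_greatest simp: not_less)
    then show False
      by (simp add: d_def)
  qed
  then obtain t where t: "\<And>n. t n \<in> S" "\<And>n. dist x (t n) < d + 1 / Suc n"
    by metis
  have lim: "(\<lambda>n. dist x (t n)) \<longlonglongrightarrow> d"
  proof (rule tendsto_sandwich[where f = "\<lambda>_. d" and h = "\<lambda>n. d + 1 / Suc n"])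
    show "(\<lambda>n. d + 1 / Suc n) \<longlonglongrightarrow> d"
      using tendsto_add[OF tendsto_const LIMSEQ_inverse_real_of_nat, of d]
      by (simp add: inverse_eq_divide)
  qed (use t d_le in \<open>auto intro!: always_eventually less_imp_le\<close>)
  have parallelogram: "(dist (t m) (t n))\<^sup>2 \<le> 2 * (dist x (t m))\<^sup>2 + 2 * (dist x (t n))\<^sup>2 - 4 * d\<^sup>2"
    for m n
  proof -
    \<comment> \<open>The midpoint stays in \<open>S\<close> by convexity, so its distance from
      \<open>x\<close> is at least \<open>d\<close>; the parallelogram identity turns this into an
      upper bound for the distance of \<open>t m\<close> and \<open>t n\<close>.\<close>
    define p where "p = (1/2) *\<^sub>R t m + (1/2) *\<^sub>R t n"
    have "p \<in> S"
      unfolding p_def using \<open>convex S\<close> t(1) by (intro convexD) auto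
    then have "d\<^sup>2 \<le> (dist x p)\<^sup>2"
      by (intro power_mono d_le) (simp_all add: d_def infdist_nonneg)
    moreover have "(dist (t m) (t n))\<^sup>2 = 2 * (dist x (t m))\<^sup>2 + 2 * (dist x (t n))\<^sup>2 - 4 * (dist x p)\<^sup>2"
      unfolding p_def dist_norm power2_norm_eq_inner
      by (simp add: inner_simps inner_commute algebra_simps)
    ultimately show ?thesis
      by simp
  qed
  have "Cauchy t"
  proof (rule metric_CauchyI)
    fix e :: real
    assume "0 < e"
    have "(\<lambda>n. (dist x (t n))\<^sup>2) \<longlonglongrightarrow> d\<^sup>2"
      using lim by (intro tendsto_intros)
    \<comment> \<open>The excess \<open>e\<^sup>2 / 4\<close> enters the parallelogram bound twice
      with factor 2, which adds up to exactly \<open>e\<^sup>2\<close>.\<close>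
    then have "\<forall>\<^sub>F n in sequentially. (dist x (t n))\<^sup>2 < d\<^sup>2 + e\<^sup>2 / 4"
      using \<open>0 < e\<close> by (intro order_tendstoD(2)) auto
    then obtain n0 where n0: "\<And>n. n \<ge> n0 \<Longrightarrow> (dist x (t n))\<^sup>2 < d\<^sup>2 + e\<^sup>2 / 4"
      by (auto simp: eventually_sequentially)
    have "dist (t m) (t n) < e" if "m \<ge> n0" "n \<ge> n0" for m n
    proof -
      have "(dist (t m) (t n))\<^sup>2 < e\<^sup>2"
        using parallelogram[of m n] n0[OF that(1)] n0[OF that(2)] by simp
      then show ?thesis
        using \<open>0 < e\<close> by (simp add: power2_less_imp_less)
    qed
    then show "\<exists>n0. \<forall>m\<ge>n0. \<forall>n\<ge>n0. dist (t m) (t n) < e"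
      by blast
  qed
  then obtain y where y: "t \<longlonglongrightarrow> y"
    using Cauchy_convergent convergent_def by blast
  show thesis
  proof
    show "y \<in> S"
      using \<open>closed S\<close> t(1) y by (rule closed_sequentially)
    have "(\<lambda>n. dist x (t n)) \<longlonglongrightarrow> dist x y"
      using y by (intro tendsto_intros)
    then have "dist x y = d"
      using lim by (rule LIMSEQ_unique)
    then show "dist x y \<le> dist x z" if "z \<in> S" for z
      using d_le that by simp
  qed
qed

text \<open>Take \<open>y\<close> closest to \<open>x\<close>. If \<open>x - y\<close> had a
  component along some \<open>s\<close> in \<open>S\<close>, moving \<open>y\<close> in that
  direction would bring it closer.\<close>

lemma ex_orth_decomposition:
  fixes x :: "'a::chilbert_space"
  assumes "csubspace S" "closed S"
  obtains y where "y \<in> S" "x - y \<in> orth_compl S"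
proof -
  have sub: "subspace S"
    using assms by (simp add: csubspace_imp_subspace)
  obtain y where y: "y \<in> S" "\<And>z. z \<in> S \<Longrightarrow> dist x y \<le> dist x z"
    using ex_closest_point_complete[of S x] assms(2) sub subspace_imp_convex subspace_0 by blast
  have orth: "inner (x - y) s = 0" if "s \<in> S" for s
  proof (cases "s = 0")
    case False
    \<comment> \<open>The coefficient of the real projection of \<open>x - y\<close> onto the line
      through \<open>s\<close>, which minimises the distance along that line.\<close>
    define c where "c = inner (x - y) s / inner s s"
    have "y + c *\<^sub>R s \<in> S"
      using sub y(1) that by (simp add: subspace_add subspace_scale)
    then have "(norm (x - y))\<^sup>2 \<le> (norm ((x - y) - c *\<^sub>R s))\<^sup>2"
      using y(2)[of "y + c *\<^sub>R s"] by (simp add: dist_norm diff_diff_eq)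
    \<comment> \<open>The instantiated rules expand only the outer difference and keep
      \<open>x - y\<close> as an atom.\<close>
    also have "\<dots> = (norm (x - y))\<^sup>2 - 2 * c * inner (x - y) s + c\<^sup>2 * inner s s"
      unfolding power2_norm_eq_inner inner_diff_left[of "x - y"] inner_diff_right[of _ "x - y"]
      by (simp add: inner_commute[of s "x - y"] power2_eq_square)
    also have "\<dots> = (norm (x - y))\<^sup>2 - (inner (x - y) s)\<^sup>2 / inner s s"
      using False by (simp add: c_def power2_eq_square)
    finally have "(inner (x - y) s)\<^sup>2 / inner s s \<le> 0"
      by simp
    moreover have "inner s s > 0"
      using False by simp
    ultimately show ?thesis
      by (simp add: divide_le_0_iff)
  qed simp
  \<comment> \<open>Real orthogonality to both \<open>s\<close> and \<open>\<i> *\<^sub>C s\<close>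
    gives both components of \<open>cinner (x - y) s\<close>.\<close>
  have "\<i> *\<^sub>C s \<in> S" if "s \<in> S" for s
    using assms(1) that by (simp add: complex_vector.subspace_scale)
  then have "x - y \<in> orth_compl S"
    by (simp add: orth_compl_def cinner_eq_Complex orth complex_eq_iff)
  with y(1) show thesis
    by (rule that)
qed

section \<open>The orthogonal projection as an idempotent linear map\<close>

lemma orth_compl_Int_self:
  assumes "x \<in> S" "x \<in> orth_compl S"
  shows "x = (0 :: 'a::complex_inner)"
proof -
  have "inner x x = 0"
    using assms by (simp add: orth_compl_def inner_eq_Re_cinner)
  then show ?thesis
    by simp
qed

text \<open>Two candidates differ by a vector lying in both \<open>S\<close> and its complement,
  hence by 0. This replaces the definite description by a membership test, through which the later
  properties of \<open>orth_proj\<close> are obtained.\<close>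

lemma orth_proj_eqI:
  assumes "csubspace (S :: 'a::complex_inner set)" "y \<in> S" "x - y \<in> orth_compl S"
  shows "orth_proj S x = y"
  unfolding orth_proj_def
proof (rule the_equality)
  fix z
  assume z: "z \<in> S \<and> x - z \<in> orth_compl S"
  have "z - y \<in> S"
    using assms z by (simp add: complex_vector.subspace_diff)
  moreover have "z - y \<in> orth_compl S"
    using complex_vector.subspace_diff[OF csubspace_orth_compl assms(3), of "x - z"] z by simp
  ultimately have "z - y = 0"
    by (rule orth_compl_Int_self)
  then show "z = y"
    by simp
qed (use assms in auto)

context
  fixes S :: "'a::chilbert_space set"
  assumes S: "csubspace S" "closed S"
begin

lemma orth_proj_in: "orth_proj S x \<in> S"
  and orth_proj_diff_in: "x - orth_proj S x \<in> orth_compl S"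
  using ex_orth_decomposition[OF S, of x] orth_proj_eqI[OF S(1)] by metis+

lemma linear_orth_proj: "Vector_Spaces.linear scaleC scaleC (orth_proj S)"
proof -
  have "orth_proj S (x + y) = orth_proj S x + orth_proj S y" for x y
  proof (rule orth_proj_eqI[OF S(1)])
    show "orth_proj S x + orth_proj S y \<in> S"
      using S(1) orth_proj_in by (simp add: complex_vector.subspace_add)
    show "x + y - (orth_proj S x + orth_proj S y) \<in> orth_compl S"
      using complex_vector.subspace_add[OF csubspace_orth_compl orth_proj_diff_in orth_proj_diff_in, of x y]
      by (simp add: algebra_simps)
  qed
  moreover have "orth_proj S (c *\<^sub>C x) = c *\<^sub>C orth_proj S x" for c x
  proof (rule orth_proj_eqI[OF S(1)])
    show "c *\<^sub>C orth_proj S x \<in> S"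
      using S(1) orth_proj_in by (simp add: complex_vector.subspace_scale)
    show "c *\<^sub>C x - c *\<^sub>C orth_proj S x \<in> orth_compl S"
      using complex_vector.subspace_scale[OF csubspace_orth_compl orth_proj_diff_in, of c x]
      by (simp add: complex_vector.scale_right_diff_distrib)
  qed
  ultimately show ?thesis
    by unfold_locales
qed

lemma orth_proj_idem: "orth_proj S (orth_proj S x) = orth_proj S x"
  by (rule orth_proj_eqI[OF S(1) orth_proj_in])
    (simp add: complex_vector.subspace_0[OF csubspace_orth_compl])

lemma orth_proj_eq_0_iff: "orth_proj S x = 0 \<longleftrightarrow> x \<in> orth_compl S"
  using orth_proj_diff_in[of x] orth_proj_eqI[OF S(1), of 0 x] complex_vector.subspace_0[OF S(1)]
  by auto

end

section \<open>Double complements and complements of sums\<close>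

text \<open>For the harder inclusion, split \<open>x\<close> along \<open>closure M\<close>. The
  residual lies in \<open>orth_compl M\<close> and also in its complement, so it vanishes and
  \<open>x\<close> is its own component in \<open>closure M\<close>.\<close>

lemma orth_compl_orth_compl:
  assumes "csubspace (M :: 'a::chilbert_space set)"
  shows "orth_compl (orth_compl M) = closure M"
proof
  have "M \<subseteq> orth_compl (orth_compl M)"
    using cinner_eq_0_commute by (auto simp: orth_compl_def)
  then show "closure M \<subseteq> orth_compl (orth_compl M)"
    by (simp add: closure_minimal closed_orth_compl)
next
  show "orth_compl (orth_compl M) \<subseteq> closure M"
  proof
    fix x
    assume x: "x \<in> orth_compl (orth_compl M)"
    obtain y where y: "y \<in> closure M" "x - y \<in> orth_compl (closure M)"
      using ex_orth_decomposition[OF csubspace_closure[OF assms] closed_closure] .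
    have "y \<in> orth_compl (orth_compl M)"
      using y(1) cinner_eq_0_commute
      by (subst orth_compl_closure[symmetric]) (auto simp: orth_compl_def)
    then have "x - y \<in> orth_compl (orth_compl M)"
      using x by (simp add: complex_vector.subspace_diff csubspace_orth_compl)
    then have "x - y = 0"
      using y(2) by (intro orth_compl_Int_self[of _ "orth_compl M"]) (simp_all add: orth_compl_closure)
    then show "x \<in> closure M"
      using y(1) by simp
  qed
qed

text \<open>Both summands contain 0 and so lie in the sum. Together with the double complement this
  identifies the kernel of \<open>P\<close>.\<close>

lemma orth_compl_set_plus:
  fixes A B :: "'a::complex_inner set"
  assumes "csubspace A" "csubspace B"
  shows "orth_compl (A + B) = orth_compl A \<inter> orth_compl B"
proof -
  have "A \<subseteq> A + B" "B \<subseteq> A + B"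
    using assms[THEN complex_vector.subspace_0] set_zero_plus2[of B A] set_zero_plus2[of A B]
    by (simp_all add: add.commute[of B A])
  then have "orth_compl (A + B) \<subseteq> orth_compl A \<inter> orth_compl B"
    unfolding orth_compl_def by blast
  then show ?thesis
    by (auto simp: orth_compl_def set_plus_def cinner_add_right)
qed

section \<open>The compressed relation\<close>

lemma rel_product_op_graph_proj_rel:
  "rel_product (op_graph f) (proj_rel M N) = {(m + n, f m) | m n. m \<in> M \<and> n \<in> N}"
  unfolding rel_product_def op_graph_def proj_rel_def by blast

text \<open>The argument is purely algebraic: only linearity, idempotence and the kernel of
  \<open>f\<close> enter. Keeping \<open>f\<close> and \<open>K\<close> abstract lets one proof
  serve both \<open>P\<close> and \<open>Q\<close>.\<close>

lemma is_projection_op_graph_proj_rel_iff: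
  fixes M N K :: "'a::complex_vector set"
  assumes M: "csubspace M" and N: "csubspace N"
    and lin: "Vector_Spaces.linear scaleC scaleC f"
    and idem: "\<And>x. f (f x) = f x"
    and ker: "\<And>x. f x = 0 \<longleftrightarrow> x \<in> K"
    and MN: "M \<inter> N \<subseteq> K"
  shows "is_projection (rel_product (op_graph f) (proj_rel M N)) \<longleftrightarrow>
    M + N = f ` M + (M \<inter> K) + N \<and> f ` M \<subseteq> M + (N \<inter> K)"
proof -
  interpret f: Vector_Spaces.linear scaleC scaleC f
    by (rule lin)
  define E where "E = rel_product (op_graph f) (proj_rel M N)"
  have E_iff: "(x, y) \<in> E \<longleftrightarrow> (\<exists>m\<in>M. \<exists>n\<in>N. x = m + n \<and> y = f m)" for x y
    unfolding E_def rel_product_op_graph_proj_rel by blast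
  have EI: "(m + n, f m) \<in> E" if "m \<in> M" "n \<in> N" for m n
    using that E_iff by blast
  note zero = complex_vector.subspace_0[OF M] complex_vector.subspace_0[OF N]
  \<comment> \<open>Two decompositions of the same vector differ by an element of
    \<open>M \<inter> N\<close>, which \<open>f\<close> annihilates; hence \<open>E\<close> is an
    operator.\<close>
  have f_eq: "f m = f m'" if "m \<in> M" "n \<in> N" "m' \<in> M" "n' \<in> N" "m + n = m' + n'" for m n m' n'
  proof -
    have "m - m' = n' - n"
      using that(5) by (simp add: algebra_simps)
    moreover have "m - m' \<in> M" "n' - n \<in> N"
      using that M N by (simp_all add: complex_vector.subspace_diff)
    ultimately have "f (m - m') = 0"
      using MN ker by auto
    then show ?thesis
      by (simp add: f.diff)
  qed
  have single_valued: "y = y'" if "(x, y) \<in> E" "(x, y') \<in> E" for x y y'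
    using that f_eq unfolding E_iff by metis
  have linear: "linear_relation E"
    unfolding linear_relation_def complex_vector.subspace_def
  proof (intro conjI ballI allI)
    show "0 \<in> E"
      using EI[OF zero] by (simp add: zero_prod_def f.zero)
    show "p + q \<in> E" if pq: "p \<in> E" "q \<in> E" for p q
    proof -
      obtain m n m' n' where mn: "m \<in> M" "n \<in> N" "p = (m + n, f m)"
        "m' \<in> M" "n' \<in> N" "q = (m' + n', f m')"
        using pq by (cases p; cases q) (auto simp: E_iff)
      then have "((m + m') + (n + n'), f (m + m')) \<in> E"
        using M N by (intro EI) (simp_all add: complex_vector.subspace_add)
      then show ?thesis
        by (simp add: mn f.add ac_simps)
    qed
    show "c *\<^sub>C p \<in> E" if p: "p \<in> E" for c p
    proof -
      obtain m n where mn: "m \<in> M" "n \<in> N" "p = (m + n, f m)"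
        using p by (cases p) (auto simp: E_iff)
      then have "(c *\<^sub>C m + c *\<^sub>C n, f (c *\<^sub>C m)) \<in> E"
        using M N by (intro EI) (simp_all add: complex_vector.subspace_scale)
      then show ?thesis
        by (simp add: mn f.scale scaleC_prod_def scaleC_add_right)
    qed
  qed
  then have "(0, 0) \<in> E"
    unfolding linear_relation_def using complex_vector.subspace_0 by (metis zero_prod_def)
  then have mul: "mul E = {0}"
    using single_valued by (auto simp: mul_def)
  have proj_iff: "is_projection E \<longleftrightarrow> (\<forall>m\<in>M. (f m, f m) \<in> E)"
  proof
    assume "is_projection E"
    then have EE: "rel_product E E = E"
      by (simp add: is_projection_def)
    show "\<forall>m\<in>M. (f m, f m) \<in> E"
    proof
      fix m
      assume "m \<in> M"
      then have mE: "(m, f m) \<in> E"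
        using EI[of m 0] zero by simp
      \<comment> \<open>Single-valuedness forces the intermediate vector \<open>z\<close> to be
        \<open>f m\<close>.\<close>
      then obtain z where z: "(m, z) \<in> E" "(z, f m) \<in> E"
        using EE unfolding rel_product_def by blast
      then show "(f m, f m) \<in> E"
        using single_valued mE by blast
    qed
  next
    assume *: "\<forall>m\<in>M. (f m, f m) \<in> E"
    have fixed: "(y, y) \<in> E" if "(x, y) \<in> E" for x y
      using * that[unfolded E_iff] by blast
    have "rel_product E E = E"
    proof (intro set_eqI iffI; clarify)
      fix x y
      assume "(x, y) \<in> rel_product E E"
      then obtain z where z: "(x, z) \<in> E" "(z, y) \<in> E"
        unfolding rel_product_def by blast
      then have "z = y"
        using fixed single_valued by blast
      then show "(x, y) \<in> E"
        using z by simp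
    next
      fix x y
      assume "(x, y) \<in> E"
      then show "(x, y) \<in> rel_product E E"
        using fixed unfolding rel_product_def by blast
    qed
    moreover have "Range E \<subseteq> Domain E"
      using fixed by blast
    ultimately show "is_projection E"
      using linear mul by (simp add: is_projection_def)
  qed
  have fixed_iff: "(f m, f m) \<in> E \<longleftrightarrow> f m \<in> M + (N \<inter> K)" for m
  proof
    assume "(f m, f m) \<in> E"
    then obtain m' n' where mn: "m' \<in> M" "n' \<in> N" "f m = m' + n'" "f m = f m'"
      unfolding E_iff by blast
    have "f m = f m' + f n'"
      using mn(3) idem f.add by metis
    then have "n' \<in> K"
      using mn(4) ker by simp
    then show "f m \<in> M + (N \<inter> K)"
      using mn by (auto simp: set_plus_def)
  next
    assume "f m \<in> M + (N \<inter> K)"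
    then obtain m' n' where mn: "m' \<in> M" "n' \<in> N" "n' \<in> K" "f m = m' + n'"
      by (auto simp: set_plus_def)
    have "f m = f m' + f n'"
      using mn(4) idem f.add by metis
    then have "f m = f m'"
      using mn(3) ker by simp
    then show "(f m, f m) \<in> E"
      unfolding E_iff using mn by blast
  qed
  have sum_eq: "M + N = f ` M + (M \<inter> K) + N" if incl: "f ` M \<subseteq> M + (N \<inter> K)"
  proof
    show "M + N \<subseteq> f ` M + (M \<inter> K) + N"
    proof
      fix x
      assume "x \<in> M + N"
      then obtain m n where mn: "m \<in> M" "n \<in> N" "x = m + n"
        by (auto simp: set_plus_def)
      then have "f m \<in> M + (N \<inter> K)"
        using incl by blast
      then obtain m' n' where mn': "m' \<in> M" "n' \<in> N" "n' \<in> K" "f m = m' + n'"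
        by (auto simp: set_plus_def)
      have "f m = f m' + f n'"
        using mn'(4) idem f.add by metis
      then have "f (m - m') = 0"
        using mn'(3) ker by (simp add: f.diff)
      then have "m - m' \<in> M \<inter> K"
        using mn(1) mn'(1) M ker by (simp add: complex_vector.subspace_diff)
      moreover have "n - n' \<in> N"
        using mn(2) mn'(2) N by (simp add: complex_vector.subspace_diff)
      moreover have "x = f m + (m - m') + (n - n')"
        by (simp add: mn(3) mn'(4))
      ultimately show "x \<in> f ` M + (M \<inter> K) + N"
        using mn(1) by (auto simp: set_plus_def)
    qed
    \<comment> \<open>For the reverse inclusion every summand already lies in \<open>M + N\<close>,
      and repeated copies of a subspace are absorbed.\<close>
    have "f ` M \<subseteq> M + N"
      using incl set_plus_mono2[of M M "N \<inter> K" N] by blast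
    then have "f ` M + (M \<inter> K) + N \<subseteq> (M + N) + M + N"
      by (intro set_plus_mono2) auto
    also have "\<dots> = (M + M) + (N + N)"
      by (simp add: ac_simps)
    also have "\<dots> \<subseteq> M + N"
      using M N by (intro set_plus_mono2) (auto simp: set_plus_def complex_vector.subspace_add)
    finally show "f ` M + (M \<inter> K) + N \<subseteq> M + N" .
  qed
  show ?thesis
    using proj_iff fixed_iff sum_eq unfolding E_def[symmetric] by blast
qed

section \<open>The kernels of the two concrete projections\<close>

theorem corollary4p10:
  fixes M N :: "'a::chilbert_space set"
    and P Q :: "'a \<Rightarrow> 'a"
  assumes "separable_space (euclidean :: 'a topology)"
    and "csubspace M" and "csubspace N"
    and "P = orth_proj (closure (orth_compl M + orth_compl N))"
    and "Q = orth_proj (orth_compl (M \<inter> N))"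
  shows "(is_projection (rel_product (op_graph P) (proj_rel M N)) \<longleftrightarrow>
            M + N = P ` M + (M \<inter> closure N) + N \<and>
            P ` M \<subseteq> M + (N \<inter> closure M)) \<and>
         (is_projection (rel_product (op_graph Q) (proj_rel M N)) \<longleftrightarrow>
            M + N = Q ` M + (M \<inter> closure (M \<inter> N)) + N \<and>
            Q ` M \<subseteq> M + (N \<inter> closure (M \<inter> N)))"
proof
  let ?S = "closure (orth_compl M + orth_compl N)"
  let ?K = "closure M \<inter> closure N"
  have S: "csubspace ?S" "closed ?S"
    by (simp_all add: csubspace_closure csubspace_set_plus csubspace_orth_compl)
  \<comment> \<open>The complement of the sum is the intersection of the double complements, that
    is, of the two closures.\<close>
  have "orth_compl ?S = ?K"
    using assms(2,3)
    by (simp add: orth_compl_closure orth_compl_set_plus csubspace_orth_compl orth_compl_orth_compl)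
  then have "is_projection (rel_product (op_graph P) (proj_rel M N)) \<longleftrightarrow>
      M + N = P ` M + (M \<inter> ?K) + N \<and> P ` M \<subseteq> M + (N \<inter> ?K)"
    unfolding assms(4) using closure_subset[of M] closure_subset[of N]
    by (intro is_projection_op_graph_proj_rel_iff assms(2,3) linear_orth_proj[OF S]
        orth_proj_idem[OF S]) (auto simp: orth_proj_eq_0_iff[OF S])
  \<comment> \<open>The criterion produces intersections with the whole kernel; the closure of the
    subspace itself is absorbed, leaving the stated form.\<close>
  moreover have "M \<inter> ?K = M \<inter> closure N" "N \<inter> ?K = N \<inter> closure M"
    using closure_subset by blast+
  ultimately show "is_projection (rel_product (op_graph P) (proj_rel M N)) \<longleftrightarrow>
      M + N = P ` M + (M \<inter> closure N) + N \<and> P ` M \<subseteq> M + (N \<inter> closure M)"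
    by simp
next
  let ?S = "orth_compl (M \<inter> N)"
  have S: "csubspace ?S" "closed ?S"
    by (simp_all add: csubspace_orth_compl closed_orth_compl)
  have "orth_compl ?S = closure (M \<inter> N)"
    using assms(2,3) by (simp add: orth_compl_orth_compl complex_vector.subspace_inter)
  then show "is_projection (rel_product (op_graph Q) (proj_rel M N)) \<longleftrightarrow>
      M + N = Q ` M + (M \<inter> closure (M \<inter> N)) + N \<and> Q ` M \<subseteq> M + (N \<inter> closure (M \<inter> N))"
    unfolding assms(5) using closure_subset[of "M \<inter> N"]
    by (intro is_projection_op_graph_proj_rel_iff assms(2,3) linear_orth_proj[OF S]
        orth_proj_idem[OF S]) (auto simp: orth_proj_eq_0_iff[OF S])
qed

end
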